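(* Let $\lambda$ be a nonzero real number, let $r$ be a positive integer, let $Y$ be a real random variable whose moment generating function $E[e^{tY}]$ exists in a neighborhood of $t=0$, let $(Y_j)_{j\ge 1}$ be a sequence of mutually independent copies of $Y$, and let $S_0=0$, $S_k=Y_1+\cdots+Y_k$ for $k\ge 1$. Then for all integers $n,j\ge 0$ and all $y$, $$\phi_{j+n,\lambda}^{(r,Y)}(y)=\sum_{l=0}^{n}\binom{n}{l}(r)_{n-l,\lambda}\sum_{k=0}^{l}\sum_{m=0}^{j}\frac{y^{k}}{k!}\binom{j}{m}\sum_{l_{1}+\cdots+l_{k}=l}\binom{l}{l_{1},\dots,l_{k}}\,E\bigg[(S_{k}-n\lambda)_{j-m,\lambda}\prod_{i=1}^{k}(Y_{i})_{l_{i},\lambda}\bigg]\phi_{m,\lambda}^{(r,Y)}(y),$$ where the innermost sum runs over all $k$-tuples $(l_1,\dots,l_k)$ of positive integers with $l_1+\cdots+l_k=l$, and $\phi^{(r,Y)}_{n,\lambda}$ denotes the probabilistic degenerate $r$-Bell polynomials associated with $Y$.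
   Context: For real $x$ and $\lambda$, the degenerate falling factorials are $(x)_{0,\lambda}=1$ and $(x)_{n,\lambda}=x(x-\lambda)(x-2\lambda)\cdots(x-(n-1)\lambda)$ for $n\ge 1$. The degenerate exponential is $e_{\lambda}^{x}(t)=\sum_{n=0}^{\infty}(x)_{n,\lambda}\frac{t^{n}}{n!}=(1+\lambda t)^{x/\lambda}$. Accordingly $E[e_\lambda^Y(t)]=\sum_{n\ge 0}E[(Y)_{n,\lambda}]\frac{t^n}{n!}$ (all moments of $Y$ are finite). For a positive integer $r$, the probabilistic degenerate $r$-Bell polynomials associated with $Y$, $\phi_{n,\lambda}^{(r,Y)}(x)$ ($n\ge 0$), are defined by the generating function $$e^{x\left(E[e_{\lambda}^{Y}(t)]-1\right)}e_{\lambda}^{r}(t)=\sum_{n=0}^{\infty}\phi_{n,\lambda}^{(r,Y)}(x)\frac{t^{n}}{n!}.$$ $\binom{l}{l_1,\dots,l_k}=\frac{l!}{l_1!\cdots l_k!}$ is the multinomial coefficient. For $k=0$, the sum over $l_1+\cdots+l_k=l$ consists of the single empty tuple (with multinomial coefficient and product equal to $1$) if $l=0$, and is empty (equal to $0$) if $l\geq 1$. *)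

theory Defs
  imports "HOL-Probability.Probability" "HOL-Computational_Algebra.Formal_Power_Series"
begin

definition deg_ffact :: "real \<Rightarrow> real \<Rightarrow> nat \<Rightarrow> real" where
  "deg_ffact lam x n = (\<Prod>i<n. x - real i * lam)"

definition deg_exp_fps :: "real \<Rightarrow> real \<Rightarrow> real fps" where
  "deg_exp_fps lam x = Abs_fps (\<lambda>n. deg_ffact lam x n / fact n)"

text \<open>The series of \<open>E[e_lam^Y(t)]\<close> in \<open>t\<close>, with the expectation taken coefficientwise.\<close>

definition expect_deg_exp_fps :: "'a measure \<Rightarrow> ('a \<Rightarrow> real) \<Rightarrow> real \<Rightarrow> real fps" where
  "expect_deg_exp_fps M Y lam =
     Abs_fps (\<lambda>n. (\<integral>\<omega>. deg_ffact lam (Y \<omega>) n \<partial>M) / fact n)"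

text \<open>If \<open>M\<close> is a probability space, the inner series of the composition below has
  constant term \<open>0\<close>, so the composition is the usual formal one.\<close>

definition prob_deg_r_bell :: "'a measure \<Rightarrow> ('a \<Rightarrow> real) \<Rightarrow> real \<Rightarrow> nat \<Rightarrow> nat \<Rightarrow> real \<Rightarrow> real" where
  "prob_deg_r_bell M Y lam r n x =
     fact n * fps_nth ((fps_exp x oo (expect_deg_exp_fps M Y lam - 1)) * deg_exp_fps lam (real r)) n"

definition mgf_exists_near_0 :: "'a measure \<Rightarrow> ('a \<Rightarrow> real) \<Rightarrow> bool" where
  "mgf_exists_near_0 M Y \<longleftrightarrow>
     (\<exists>\<epsilon>>0. \<forall>t::real. \<bar>t\<bar> < \<epsilon> \<longrightarrow> integrable M (\<lambda>\<omega>. exp (t * Y \<omega>)))"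

text \<open>The tuples \<open>(l\<^sub>1, \<dots>, l\<^sub>k)\<close> of positive integers with sum \<open>l\<close>, as functions on \<open>{1..k}\<close>
  that are \<open>undefined\<close> elsewhere, so that each tuple is represented exactly once.\<close>

definition compositions :: "nat \<Rightarrow> nat \<Rightarrow> (nat \<Rightarrow> nat) set" where
  "compositions l k = {ls \<in> {1..k} \<rightarrow>\<^sub>E {1..}. (\<Sum>i = 1..k. ls i) = l}"

definition multinomial :: "nat \<Rightarrow> nat \<Rightarrow> (nat \<Rightarrow> nat) \<Rightarrow> real" where
  "multinomial l k ls = fact l / (\<Prod>i = 1..k. fact (ls i))"

end

theory Submission
  imports Defs
begin

text \<open>
  Write \<open>G\<close> for the series of \<open>E[e_lam^Y(t)]\<close>, \<open>X = exp (y (G - 1))\<close> and \<open>R = e_lam^r\<close>, so that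
  \<open>\<phi>_{j+n}\<close> is \<open>j!\<close> times the \<open>j\<close>-th coefficient of the \<open>n\<close>-th derivative of \<open>R X\<close>. By Leibniz and
  Faa di Bruno this derivative is \<open>R X\<close> times a combination of the series
  \<open>e_lam^{-(n-l) lam} G^{(l_1)} ... G^{(l_k)}\<close> with \<open>l_1 + ... + l_k = l\<close>. Each of these is the
  expectation of \<open>e_lam^{S_k - n lam} (Y_1)_{l_1} ... (Y_k)_{l_k}\<close>: the exponent splits as
  \<open>- (n - l) lam + (Y_1 - l_1 lam) + ... + (Y_k - l_k lam)\<close>, the series
  \<open>(Y_i)_{l_i} e_lam^{Y_i - l_i lam}\<close> is the \<open>l_i\<close>-th derivative of \<open>e_lam^{Y_i}\<close>, and the \<open>Y_i\<close> are
  independent.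
\<close>

unbundle no vec_syntax
unbundle fps_syntax

section \<open>Degenerate falling factorials and degenerate exponentials\<close>

lemma deg_ffact_0 [simp]: "deg_ffact lam x 0 = 1"
  by (simp add: deg_ffact_def)

lemma deg_ffact_Suc: "deg_ffact lam x (Suc n) = deg_ffact lam x n * (x - real n * lam)"
  by (simp add: deg_ffact_def)

text \<open>The product is split after its first \<open>l\<close> factors. This is what turns
  differentiation of \<open>deg_exp_fps\<close> into a shift of its exponent.\<close>

lemma deg_ffact_add:
  "deg_ffact lam x (l + p) = deg_ffact lam x l * deg_ffact lam (x - real l * lam) p"
  by (induction p) (simp_all add: deg_ffact_Suc algebra_simps)

text \<open>Pulling \<open>lam\<close> out of every factor exhibits the coefficients of
  \<open>(1 + lam t)^(x / lam)\<close>, so that facts about \<open>fps_binomial\<close> become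
  available.\<close>

lemma deg_ffact_eq_gchoose:
  assumes "lam \<noteq> 0"
  shows "deg_ffact lam x n = lam ^ n * fact n * (x / lam gchoose n)"
proof -
  have "deg_ffact lam x n = (\<Prod>i=0..<n. lam * (x / lam - of_nat i))"
    unfolding deg_ffact_def using assms
    by (intro prod.cong) (auto simp: field_simps)
  then show ?thesis
    by (simp add: prod.distrib gbinomial_prod_rev)
qed

lemma deg_exp_fps_0 [simp]: "deg_exp_fps lam 0 = 1"
proof (rule fps_ext)
  fix n
  show "deg_exp_fps lam 0 $ n = 1 $ n"
    \<comment> \<open>The shifted product exposes the factor for index 0, which is
      \<open>x = 0\<close>.\<close>
    by (cases n) (auto simp: deg_exp_fps_def deg_ffact_def prod.lessThan_Suc_shift
        simp del: prod.lessThan_Suc)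
qed

text \<open>\<open>deg_exp_fps lam z\<close> is \<open>fps_binomial (z / lam)\<close> with
  \<open>lam t\<close> substituted for \<open>t\<close>. The substitution only scales coefficient
  \<open>k\<close> by \<open>lam ^ k\<close>, so multiplicativity in the exponent carries
  over.\<close>

lemma deg_exp_fps_add:
  assumes "lam \<noteq> 0"
  shows "deg_exp_fps lam (x + y) = deg_exp_fps lam x * deg_exp_fps lam y"
proof (rule fps_ext)
  fix n
  have c: "deg_exp_fps lam z $ k = lam ^ k * fps_binomial (z / lam) $ k" for z k
    using assms by (simp add: deg_exp_fps_def deg_ffact_eq_gchoose)
  have "deg_exp_fps lam (x + y) $ n
      = lam ^ n * (\<Sum>i=0..n. fps_binomial (x / lam) $ i * fps_binomial (y / lam) $ (n - i))"
    unfolding c by (simp add: add_divide_distrib fps_binomial_add_mult fps_mult_nth)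
  also have "\<dots> = (\<Sum>i=0..n. deg_exp_fps lam x $ i * deg_exp_fps lam y $ (n - i))"
    unfolding sum_distrib_left
  proof (rule sum.cong)
    fix i assume "i \<in> {0..n}"
    then have "lam ^ n = lam ^ i * lam ^ (n - i)"
      by (simp flip: power_add)
    then show "lam ^ n * (fps_binomial (x / lam) $ i * fps_binomial (y / lam) $ (n - i))
        = deg_exp_fps lam x $ i * deg_exp_fps lam y $ (n - i)"
      unfolding c by (simp only: mult_ac)
  qed simp
  finally show "deg_exp_fps lam (x + y) $ n = (deg_exp_fps lam x * deg_exp_fps lam y) $ n"
    by (simp add: fps_mult_nth)
qed

lemma deg_exp_fps_sum:
  assumes "lam \<noteq> 0" "finite I"
  shows "deg_exp_fps lam (\<Sum>i\<in>I. f i) = (\<Prod>i\<in>I. deg_exp_fps lam (f i))"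
  using assms(2) by induction (simp_all add: deg_exp_fps_add[OF assms(1)])

section \<open>Constant factors and higher derivatives of formal power series\<close>

lemma prod_fps_const: "(\<Prod>i\<in>A. fps_const (g i)) = fps_const (\<Prod>i\<in>A. g i :: 'a :: comm_ring_1)"
  by (induction A rule: infinite_finite_induct) simp_all

lemma fps_higher_deriv_nth:
  "(fps_deriv ^^ n) f $ j = fact (j + n) / fact j * (f $ (j + n) :: 'a :: field_char_0)"
proof (induction n arbitrary: j)
  case (Suc n)
  show ?case
    using of_nat_neq_0[of j, where ?'a = 'a]
    by (simp add: Suc divide_simps)
qed simp

lemma fps_higher_deriv_mult:
  fixes f g :: "'a :: comm_ring_1 fps"
  shows "(fps_deriv ^^ n) (f * g)
    = (\<Sum>i=0..n. of_nat (n choose i) * ((fps_deriv ^^ (n - i)) f * (fps_deriv ^^ i) g))"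
proof (induction n)
  case (Suc n)
  define a where "a i = (fps_deriv ^^ i) f" for i
  define b where "b i = (fps_deriv ^^ i) g" for i
  have a: "fps_deriv (a i) = a (Suc i)" and b: "fps_deriv (b i) = b (Suc i)" for i
    by (simp_all add: a_def b_def)
  have c: "fps_deriv (of_nat m * h) = of_nat m * fps_deriv h" for m and h :: "'a fps"
    by (simp add: fps_of_nat[symmetric])
  have "(fps_deriv ^^ Suc n) (f * g)
      = fps_deriv (\<Sum>i=0..n. of_nat (n choose i) * (a (n - i) * b i))"
    using Suc by (simp add: a_def b_def)
  also have "\<dots> = (\<Sum>i=0..n. of_nat (n choose i) * (a (n - i) * b (Suc i)))
      + (\<Sum>i=0..n. of_nat (n choose i) * (a (Suc n - i) * b i))"
    unfolding fps_deriv_sum sum.distrib[symmetric]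
    by (intro sum.cong) (simp_all add: c a b Suc_diff_le algebra_simps)
  also have "(\<Sum>i=0..n. of_nat (n choose i) * (a (Suc n - i) * b i))
      = a (Suc n) * b 0 + (\<Sum>i=0..n. of_nat (n choose Suc i) * (a (n - i) * b (Suc i)))"
  proof -
    \<comment> \<open>The added term \<open>i = Suc n\<close> is zero because
      \<open>n choose Suc n\<close> is; peeling off \<open>i = 0\<close> then aligns both sums for
      Pascal's rule.\<close>
    have "(\<Sum>i=0..n. of_nat (n choose i) * (a (Suc n - i) * b i))
        = (\<Sum>i=0..Suc n. of_nat (n choose i) * (a (Suc n - i) * b i))"
      by (simp add: binomial_eq_0)
    also have "\<dots> = a (Suc n) * b 0 + (\<Sum>i=0..n. of_nat (n choose Suc i) * (a (n - i) * b (Suc i)))"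
      by (subst sum.atLeast0_atMost_Suc_shift) simp
    finally show ?thesis .
  qed
  also have "(\<Sum>i=0..n. of_nat (n choose i) * (a (n - i) * b (Suc i))) +
      (a (Suc n) * b 0 + (\<Sum>i=0..n. of_nat (n choose Suc i) * (a (n - i) * b (Suc i))))
    = (\<Sum>i=0..Suc n. of_nat (Suc n choose i) * (a (Suc n - i) * b i))"
    by (subst sum.atLeast0_atMost_Suc_shift) (simp add: sum.distrib algebra_simps)
  finally show ?case
    by (simp only: a_def b_def)
qed simp

lemma higher_deriv_deg_exp_fps:
  "(fps_deriv ^^ n) (deg_exp_fps lam x)
    = fps_const (deg_ffact lam x n) * deg_exp_fps lam (x - real n * lam)"
  by (rule fps_ext)
    (simp add: fps_higher_deriv_nth deg_exp_fps_def add.commute[of _ n] deg_ffact_add)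

section \<open>Faa di Bruno's formula for an exponential\<close>

text \<open>The series \<open>f (t + s) - f t\<close> in \<open>s\<close>, with coefficients that are series in \<open>t\<close>. On such double
  series, \<open>fps_deriv\<close> is the derivative in \<open>s\<close> and \<open>coeff_deriv\<close> the derivative in \<open>t\<close>.\<close>

definition taylor_tail :: "'a :: field_char_0 fps \<Rightarrow> 'a fps fps" where
  "taylor_tail f = Abs_fps (\<lambda>l. if l = 0 then 0 else fps_const (1 / fact l) * (fps_deriv ^^ l) f)"

definition coeff_deriv :: "'a :: comm_ring_1 fps fps \<Rightarrow> 'a fps fps" where
  "coeff_deriv f = Abs_fps (\<lambda>l. fps_deriv (f $ l))"

lemma coeff_deriv_mult: "coeff_deriv (f * g) = f * coeff_deriv g + coeff_deriv f * g"
  by (rule fps_ext) (simp add: coeff_deriv_def fps_mult_nth fps_deriv_sum sum.distrib)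

lemma coeff_deriv_power: "coeff_deriv (f ^ n) = of_nat n * coeff_deriv f * f ^ (n - 1)"
proof (induction n)
  case 0
  show ?case by (rule fps_ext) (simp add: coeff_deriv_def)
next
  case (Suc n)
  then show ?case
    by (cases n) (simp_all add: coeff_deriv_mult algebra_simps)
qed

text \<open>\<open>f (t + s)\<close> has the same derivative in \<open>s\<close> as in
  \<open>t\<close>. Subtracting \<open>f t\<close> changes only the derivative in \<open>t\<close>,
  which accounts for the extra \<open>fps_deriv f\<close>.\<close>

lemma fps_deriv_taylor_tail:
  "fps_deriv (taylor_tail f) = fps_const (fps_deriv f) + coeff_deriv (taylor_tail f)"
proof (rule fps_ext)
  fix l
  have "of_nat (Suc l) * (fps_const (1 / fact (Suc l)) :: 'a fps)
      = fps_const (of_nat (Suc l) * (1 / fact (Suc l)))"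
    by (simp only: fps_of_nat[symmetric] fps_const_mult)
  also have "of_nat (Suc l) * (1 / fact (Suc l)) = (1 / fact l :: 'a)"
    by (simp add: field_simps del: of_nat_Suc)
  finally have *: "of_nat (Suc l) * (fps_const (1 / fact (Suc l)) * h)
      = fps_const (1 / fact l) * h" for h :: "'a fps"
    by (simp only: mult.assoc[symmetric])
  have "fps_deriv (taylor_tail f) $ l = of_nat (Suc l) * (fps_const (1 / fact (Suc l)) * (fps_deriv ^^ Suc l) f)"
    by (simp add: taylor_tail_def)
  also have "\<dots> = fps_const (1 / fact l) * (fps_deriv ^^ Suc l) f"
    by (rule *)
  also have "\<dots> = (fps_const (fps_deriv f) + coeff_deriv (taylor_tail f)) $ l"
    by (simp add: taylor_tail_def coeff_deriv_def)
  finally show "fps_deriv (taylor_tail f) $ l = \<dots>" .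
qed

text \<open>The tail is divisible by \<open>s\<close>, so its \<open>k\<close>-th power starts at
  order \<open>k\<close>; hence \<open>deriv_bell f l k\<close> vanishes for
  \<open>k > l\<close>.\<close>

lemma taylor_tail_power_nth_eq_0:
  assumes "l < k"
  shows "(taylor_tail f ^ k) $ l = 0"
  using assms by (intro startsby_zero_power_prefix[rule_format]) (auto simp: taylor_tail_def)

text \<open>\<open>k!\<close> times the partial Bell polynomial \<open>B_{l,k}\<close> in the derivatives of \<open>f\<close>.\<close>

definition deriv_bell :: "'a :: field_char_0 fps \<Rightarrow> nat \<Rightarrow> nat \<Rightarrow> 'a fps" where
  "deriv_bell f l k = fps_const (fact l) * (taylor_tail f ^ k) $ l"

text \<open>Raising \<open>l\<close> amounts to differentiating the \<open>k\<close>-th power of the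
  tail in \<open>s\<close>, and \<open>fps_deriv_taylor_tail\<close> trades this for a derivative in
  \<open>t\<close>. At \<open>k = 0\<close> the truncated \<open>k - 1\<close> is harmless because
  of the factor \<open>of_nat k\<close>.\<close>

lemma deriv_bell_Suc:
  "deriv_bell f (Suc l) k
    = of_nat k * fps_deriv f * deriv_bell f l (k - 1) + fps_deriv (deriv_bell f l k)"
proof -
  let ?A = "taylor_tail f"
  have "deriv_bell f (Suc l) k = fps_const (fact l) * fps_deriv (?A ^ k) $ l"
    by (simp add: deriv_bell_def fps_of_nat[symmetric] mult.assoc[symmetric] algebra_simps)
  also have "fps_deriv (?A ^ k)
      = of_nat k * fps_const (fps_deriv f) * ?A ^ (k - 1) + coeff_deriv (?A ^ k)"
    by (simp add: fps_deriv_power' fps_deriv_taylor_tail coeff_deriv_power algebra_simps)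
  also have "fps_const (fact l) * (\<dots> $ l)
      = of_nat k * fps_deriv f * deriv_bell f l (k - 1) + fps_deriv (deriv_bell f l k)"
    by (simp add: deriv_bell_def coeff_deriv_def fps_of_nat[symmetric] algebra_simps
        flip: fps_const_mult)
  finally show ?thesis .
qed

text \<open>Each outer derivative only contributes a factor \<open>y\<close>, so the exponential
  stays as a common factor. The hypothesis makes the constant term of \<open>f - 1\<close> zero, as
  the chain rule for composition requires.\<close>

lemma higher_deriv_fps_exp_compose:
  fixes f :: "'a :: field_char_0 fps"
  assumes "f $ 0 = 1"
  shows "(fps_deriv ^^ l) (fps_exp y oo (f - 1))
    = (fps_exp y oo (f - 1)) * (\<Sum>k=0..l. fps_const (y ^ k / fact k) * deriv_bell f l k)"
proof (induction l)
  case 0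
  show ?case by (simp add: deriv_bell_def)
next
  case (Suc l)
  let ?X = "fps_exp y oo (f - 1)"
  let ?c = "\<lambda>k. fps_const (y ^ k / fact k)"
  have X: "fps_deriv ?X = fps_const y * fps_deriv f * ?X"
    using assms by (simp add: fps_compose_deriv fps_compose_mult_distrib)
  \<comment> \<open>This removes the top term from the second sum below, which then runs to
    \<open>l\<close> as in the induction hypothesis.\<close>
  have z: "deriv_bell f l (Suc l) = 0"
    by (simp add: deriv_bell_def taylor_tail_power_nth_eq_0 del: power_Suc)
  have c: "?c (Suc k) * of_nat (Suc k) = fps_const y * ?c k" for k
    by (simp add: fps_of_nat[symmetric] field_simps del: of_nat_Suc)
  have "(\<Sum>k=0..Suc l. ?c k * deriv_bell f (Suc l) k)
      = (\<Sum>k=0..Suc l. ?c k * (of_nat k * fps_deriv f * deriv_bell f l (k - 1)))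
        + (\<Sum>k=0..Suc l. ?c k * fps_deriv (deriv_bell f l k))"
    by (simp only: deriv_bell_Suc sum.distrib distrib_left)
  \<comment> \<open>The term \<open>k = 0\<close> is killed by \<open>of_nat k\<close>. After the
    shift, \<open>c\<close> cancels \<open>Suc k\<close> against the factorial and frees one
    \<open>y\<close>, matching the chain rule term in \<open>X\<close>.\<close>
  also have "(\<Sum>k=0..Suc l. ?c k * (of_nat k * fps_deriv f * deriv_bell f l (k - 1)))
      = (\<Sum>k=0..l. (?c (Suc k) * of_nat (Suc k)) * fps_deriv f * deriv_bell f l k)"
    by (subst sum.atLeast0_atMost_Suc_shift) (simp add: mult.assoc del: of_nat_Suc)
  also have "\<dots> = fps_const y * fps_deriv f * (\<Sum>k=0..l. ?c k * deriv_bell f l k)"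
    unfolding c by (simp only: sum_distrib_left mult_ac)
  also have "(\<Sum>k=0..Suc l. ?c k * fps_deriv (deriv_bell f l k))
      = fps_deriv (\<Sum>k=0..l. ?c k * deriv_bell f l k)"
    by (simp add: fps_deriv_sum z)
  finally show ?case
    by (simp add: Suc X algebra_simps)
qed


section \<open>Coefficients of products as sums over compositions\<close>

text \<open>The general product formula sums over multisets \<open>X\<close> on
  \<open>{1..k}\<close>, with \<open>count X\<close> as the exponent tuple. A tuple with a zero
  entry contributes nothing, since some factor is then a constant term.\<close>

lemma prod_nth_positive:
  fixes f :: "nat \<Rightarrow> 'a :: comm_ring_1 fps"
  assumes "\<And>i. i \<in> {1..k} \<Longrightarrow> f i $ 0 = 0"
  shows "(\<Prod>i=1..k. f i) $ l = (\<Sum>ls\<in>compositions l k. \<Prod>i=1..k. f i $ ls i)"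
proof -
  let ?I = "{1..k}" and ?P = "\<lambda>X. \<forall>i\<in>{1..k}. count X i \<noteq> 0"
  have "(\<Prod>i=1..k. f i) $ l = (\<Sum>X\<in>multisets_of_size ?I l. \<Prod>i\<in>?I. f i $ count X i)"
    by (rule fps_prod_nth') simp
  also have "\<dots> = (\<Sum>X\<in>{X\<in>multisets_of_size ?I l. ?P X}. \<Prod>i\<in>?I. f i $ count X i)"
  proof (rule sum.mono_neutral_right)
    show "\<forall>X\<in>multisets_of_size ?I l - {X\<in>multisets_of_size ?I l. ?P X}.
        (\<Prod>i\<in>?I. f i $ count X i) = 0"
    proof
      fix X assume "X \<in> multisets_of_size ?I l - {X\<in>multisets_of_size ?I l. ?P X}"
      then obtain i where "i \<in> ?I" "count X i = 0"
        by blast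
      then have "i \<in> ?I" "f i $ count X i = 0"
        using assms[of i] by simp_all
      then show "(\<Prod>i\<in>?I. f i $ count X i) = 0"
        by (intro prod_zero) auto
    qed
  qed auto
  also have "\<dots> = (\<Sum>ls\<in>compositions l k. \<Prod>i\<in>?I. f i $ ls i)"
  \<comment> \<open>A tuple corresponds to the multiset containing each \<open>i\<close> exactly
    \<open>ls i\<close> times; \<open>restrict\<close> is there because \<open>compositions\<close>
    consists of extensional functions.\<close>
  proof (rule sum.reindex_bij_witness[where i = "\<lambda>ls. \<Sum>i\<in>?I. replicate_mset (ls i) i"
        and j = "\<lambda>X. restrict (count X) ?I"])
    fix X assume X: "X \<in> {X\<in>multisets_of_size ?I l. ?P X}"
    then have sub: "set_mset X \<subseteq> ?I" and sz: "size X = l"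
      by (auto simp: multisets_of_size_def)
    show "(\<Sum>i\<in>?I. replicate_mset (restrict (count X) ?I i) i) = X"
      using sub by (intro multiset_eqI) (auto simp: count_sum sum.delta count_eq_zero_iff)
    have "size X = (\<Sum>i\<in>?I. count X i)"
      unfolding size_multiset_overloaded_eq using sub
      by (intro sum.mono_neutral_left) (auto simp: count_eq_zero_iff)
    with X sz show "restrict (count X) ?I \<in> compositions l k"
      by (auto simp: compositions_def Suc_le_eq)
    show "(\<Prod>i\<in>?I. f i $ restrict (count X) ?I i) = (\<Prod>i\<in>?I. f i $ count X i)"
      by (intro prod.cong) auto
  next
    fix ls assume ls: "ls \<in> compositions l k"
    have c: "count (\<Sum>i\<in>?I. replicate_mset (ls i) i) i = ls i" if "i \<in> ?I" for i
      using that by (simp add: count_sum sum.delta)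
    show "restrict (count (\<Sum>i\<in>?I. replicate_mset (ls i) i)) ?I = ls"
      using ls c by (intro ext) (auto simp: compositions_def restrict_def PiE_def extensional_def)
    have "set_mset (\<Sum>i\<in>?I. replicate_mset (ls i) i) \<subseteq> ?I"
      by (auto simp: set_mset_sum split: if_splits)
    moreover have "size (\<Sum>i\<in>?I. replicate_mset (ls i) i) = l"
      using ls by (simp add: compositions_def size_multiset_sum)
    moreover have "?P (\<Sum>i\<in>?I. replicate_mset (ls i) i)"
      using ls c by (force simp: compositions_def PiE_iff)
    ultimately show "(\<Sum>i\<in>?I. replicate_mset (ls i) i) \<in> {X\<in>multisets_of_size ?I l. ?P X}"
      unfolding multisets_of_size_def by blast
  qed
  finally show ?thesis .
qed

lemma deriv_bell_eq_sum_compositions: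
  "deriv_bell f l k
    = (\<Sum>ls\<in>compositions l k. fps_const (multinomial l k ls) * (\<Prod>i=1..k. (fps_deriv ^^ ls i) f))"
proof -
  have "taylor_tail f ^ k = (\<Prod>i=1..k. taylor_tail f)"
    by simp
  then have "deriv_bell f l k
      = (\<Sum>ls\<in>compositions l k. fps_const (fact l) * (\<Prod>i=1..k. taylor_tail f $ ls i))"
    unfolding deriv_bell_def
    by (simp only: prod_nth_positive sum_distrib_left taylor_tail_def fps_nth_Abs_fps simp_thms if_True)
  also have "\<dots> = (\<Sum>ls\<in>compositions l k.
      fps_const (multinomial l k ls) * (\<Prod>i=1..k. (fps_deriv ^^ ls i) f))"
  proof (rule sum.cong)
    fix ls assume "ls \<in> compositions l k"
    \<comment> \<open>Entries of a composition are positive, so the zero branch of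
      \<open>taylor_tail\<close> does not occur.\<close>
    then have "taylor_tail f $ ls i = fps_const (1 / fact (ls i)) * (fps_deriv ^^ ls i) f"
      if "i \<in> {1..k}" for i
      using that by (force simp: taylor_tail_def compositions_def PiE_iff)
    then have "(\<Prod>i=1..k. taylor_tail f $ ls i)
        = (\<Prod>i=1..k. fps_const (1 / fact (ls i)) * (fps_deriv ^^ ls i) f)"
      by (intro prod.cong) auto
    also have "\<dots> = fps_const (1 / (\<Prod>i=1..k. fact (ls i))) * (\<Prod>i=1..k. (fps_deriv ^^ ls i) f)"
      by (simp add: prod.distrib prod_fps_const prod_dividef)
    finally show "fps_const (fact l) * (\<Prod>i=1..k. taylor_tail f $ ls i)
        = fps_const (multinomial l k ls) * (\<Prod>i=1..k. (fps_deriv ^^ ls i) f)"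
      by (simp add: multinomial_def mult.assoc[symmetric])
  qed simp
  finally show ?thesis .
qed

section \<open>Moments, independence and expectations of series\<close>

lemma power_div_fact_le_exp:
  fixes z :: real
  assumes "z \<ge> 0"
  shows "z ^ n / fact n \<le> exp z"
proof -
  have "(\<Sum>k\<in>{n}. z ^ k /\<^sub>R fact k) \<le> exp z"
    using exp_converges[of z] assms
    by (metis (no_types, lifting) finite.emptyI finite_insert sum_le_suminf sums_iff
        scaleR_nonneg_nonneg zero_le_power inverse_nonnegative_iff_nonnegative fact_ge_zero)
  then show ?thesis by (simp add: field_simps)
qed

lemma borel_measurable_deg_ffact [measurable]: "(\<lambda>x. deg_ffact lam x n) \<in> borel_measurable borel"
  unfolding deg_ffact_def by measurable

lemma abs_deg_ffact_le: "\<bar>deg_ffact lam x n\<bar> \<le> (\<bar>x\<bar> + real n * \<bar>lam\<bar>) ^ n"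
proof -
  have "\<bar>deg_ffact lam x n\<bar> = (\<Prod>i<n. \<bar>x - real i * lam\<bar>)"
    by (simp add: deg_ffact_def abs_prod)
  also have "\<dots> \<le> (\<Prod>i<n. \<bar>x\<bar> + real n * \<bar>lam\<bar>)"
  proof (rule prod_mono)
    fix i assume "i \<in> {..<n}"
    then have "real i * \<bar>lam\<bar> \<le> real n * \<bar>lam\<bar>"
      by (intro mult_right_mono) auto
    moreover have "\<bar>x - real i * lam\<bar> \<le> \<bar>x\<bar> + real i * \<bar>lam\<bar>"
      using abs_triangle_ineq4[of x "real i * lam"] by (simp add: abs_mult)
    ultimately show "0 \<le> \<bar>x - real i * lam\<bar> \<and> \<bar>x - real i * lam\<bar> \<le> \<bar>x\<bar> + real n * \<bar>lam\<bar>"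
      by simp
  qed
  finally show ?thesis by simp
qed

text \<open>A polynomial is dominated by a multiple of \<open>exp (t * \<bar>x\<bar>)\<close>, hence
  of \<open>exp (t * x) + exp (- t * x)\<close>, and both exponentials are integrable for small
  \<open>t\<close>.\<close>

lemma integrable_deg_ffact:
  assumes [measurable]: "Y \<in> borel_measurable N" and "mgf_exists_near_0 N Y"
  shows "integrable N (\<lambda>\<omega>. deg_ffact lam (Y \<omega>) n)"
proof -
  obtain \<epsilon> where \<epsilon>: "\<epsilon> > 0" "\<And>t. \<bar>t\<bar> < \<epsilon> \<Longrightarrow> integrable N (\<lambda>\<omega>. exp (t * Y \<omega>))"
    using assms(2) unfolding mgf_exists_near_0_def by blast
  define t where "t = \<epsilon> / 2"
  have t: "t > 0" "\<bar>t\<bar> < \<epsilon>" "\<bar>- t\<bar> < \<epsilon>"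
    using \<epsilon> by (auto simp: t_def)
  \<comment> \<open>\<open>fact n / t ^ n\<close> comes from bounding
    \<open>(t * z) ^ n / fact n\<close> by \<open>exp (t * z)\<close>; the exponential in
    \<open>C\<close> is the part of \<open>exp (t * z)\<close> independent of
    \<open>x\<close>.\<close>
  define C where "C = fact n / t ^ n * exp (t * (real n * \<bar>lam\<bar>))"
  have bound: "\<bar>deg_ffact lam x n\<bar> \<le> C * (exp (t * x) + exp (- t * x))" for x
  proof -
    define z where "z = \<bar>x\<bar> + real n * \<bar>lam\<bar>"
    have "\<bar>deg_ffact lam x n\<bar> \<le> z ^ n"
      unfolding z_def by (rule abs_deg_ffact_le)
    also have "z ^ n = fact n / t ^ n * ((t * z) ^ n / fact n)"
      using t by (simp add: power_mult_distrib)
    also have "\<dots> \<le> fact n / t ^ n * exp (t * z)"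
      using t by (intro mult_left_mono power_div_fact_le_exp) (auto simp: z_def)
    also have "\<dots> = C * exp (t * \<bar>x\<bar>)"
      by (simp add: C_def z_def distrib_left exp_add)
    also have "\<dots> \<le> C * (exp (t * x) + exp (- t * x))"
      using t by (intro mult_left_mono) (auto simp: C_def abs_if)
    finally show ?thesis .
  qed
  show ?thesis
  proof (rule Bochner_Integration.integrable_bound)
    show "integrable N (\<lambda>\<omega>. C * (exp (t * Y \<omega>) + exp (- t * Y \<omega>)))"
      using t by (intro integrable_mult_right Bochner_Integration.integrable_add \<epsilon>(2))
    show "AE \<omega> in N. norm (deg_ffact lam (Y \<omega>) n) \<le> norm (C * (exp (t * Y \<omega>) + exp (- t * Y \<omega>)))"
      using order_trans[OF bound abs_ge_self] by simp
  qed measurable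
qed

text \<open>A coefficient of the product is a finite sum of products of single coefficients.
  Expectation passes through the sum by linearity and through each product by independence.\<close>

lemma (in prob_space) expectation_fps_prod_nth:
  fixes F :: "'i \<Rightarrow> real \<Rightarrow> real fps"
  assumes "finite I" "indep_vars (\<lambda>_. borel) X I"
    and meas: "\<And>i p. i \<in> I \<Longrightarrow> (\<lambda>x. F i x $ p) \<in> borel_measurable borel"
    and int: "\<And>i p. i \<in> I \<Longrightarrow> integrable M (\<lambda>\<omega>. F i (X i \<omega>) $ p)"
  shows "expectation (\<lambda>\<omega>. (C * (\<Prod>i\<in>I. F i (X i \<omega>))) $ j)
    = (C * (\<Prod>i\<in>I. Abs_fps (\<lambda>p. expectation (\<lambda>\<omega>. F i (X i \<omega>) $ p)))) $ j"
proof -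
  have indep: "indep_vars (\<lambda>_. borel) (\<lambda>i \<omega>. F i (X i \<omega>) $ count A i) I" for A
    by (rule indep_vars_compose2[OF assms(2)]) (rule meas)
  have int_prod: "integrable M (\<lambda>\<omega>. \<Prod>i\<in>I. F i (X i \<omega>) $ count A i)" for A
    by (rule indep_vars_integrable[OF assms(1) indep int])
  have exp_prod: "expectation (\<lambda>\<omega>. \<Prod>i\<in>I. F i (X i \<omega>) $ count A i)
      = (\<Prod>i\<in>I. expectation (\<lambda>\<omega>. F i (X i \<omega>) $ count A i))" for A
    by (rule indep_vars_lebesgue_integral[OF assms(1) indep int])
  show ?thesis
    using assms(1) int_prod
    by (simp add: fps_mult_nth fps_prod_nth' exp_prod)
qed

lemma (in prob_space) expectation_deg_ffact_sum:
  assumes lam: "lam \<noteq> 0"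
    and Y: "Y \<in> borel_measurable N" "mgf_exists_near_0 N Y"
    and indep: "indep_vars (\<lambda>_. borel) X {1..}"
    and distr: "\<And>i. i \<ge> 1 \<Longrightarrow> distr M borel (X i) = distr N borel Y"
    and ls: "ls \<in> compositions l k" and l: "l \<le> n"
  shows "expectation (\<lambda>\<omega>. deg_ffact lam ((\<Sum>i=1..k. X i \<omega>) - real n * lam) j *
      (\<Prod>i=1..k. deg_ffact lam (X i \<omega>) (ls i)))
    = fact j * (deg_exp_fps lam (- (real (n - l) * lam)) *
        (\<Prod>i=1..k. (fps_deriv ^^ ls i) (expect_deg_exp_fps N Y lam))) $ j"
    (is "?lhs = fact j * (?C * _) $ j")
proof -
  have X [measurable]: "random_variable borel (X i)" if "i \<ge> 1" for i
    using indep that by (auto simp: indep_vars_def)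
  \<comment> \<open>\<open>X i\<close> and \<open>Y\<close> live on different spaces and share only
    their law, so integrability and expectations are transported through
    \<open>distr\<close>.\<close>
  have intN: "integrable (distr N borel Y) (\<lambda>x. deg_ffact lam x p)" for p
    using integrable_deg_ffact[OF Y] Y(1) by (simp add: integrable_distr_eq)
  have intM: "integrable M (\<lambda>\<omega>. deg_ffact lam (X i \<omega>) p)" if "i \<ge> 1" for i p
    using intN[of p] X[OF that] unfolding distr[OF that, symmetric]
    by (simp add: integrable_distr_eq)
  have expM: "expectation (\<lambda>\<omega>. deg_ffact lam (X i \<omega>) p) = (\<integral>\<omega>. deg_ffact lam (Y \<omega>) p \<partial>N)"
    if "i \<ge> 1" for i p
    using integral_distr[OF X[OF that] borel_measurable_deg_ffact[of lam p]]
      integral_distr[OF Y(1) borel_measurable_deg_ffact[of lam p]]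
    by (simp add: distr[OF that])
  define F where "F i x = (fps_deriv ^^ ls i) (deg_exp_fps lam x)" for i x
  have F_nth: "F i x $ p = deg_ffact lam x (p + ls i) / fact p" for i x p
    by (simp add: F_def fps_higher_deriv_nth deg_exp_fps_def)
  have ls_sum: "(\<Sum>i=1..k. ls i) = l"
    using ls by (simp add: compositions_def)
  have split: "deg_ffact lam ((\<Sum>i=1..k. X i \<omega>) - real n * lam) j *
      (\<Prod>i=1..k. deg_ffact lam (X i \<omega>) (ls i))
      = fact j * (?C * (\<Prod>i=1..k. F i (X i \<omega>))) $ j" for \<omega>
  proof -
    have "(\<Sum>i=1..k. X i \<omega>) - real n * lam
        = - (real (n - l) * lam) + (\<Sum>i=1..k. X i \<omega> - real (ls i) * lam)"
      using l unfolding sum_subtractf sum_distrib_right[symmetric] of_nat_sum[symmetric] ls_sum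
      by (simp add: of_nat_diff algebra_simps)
    then have "deg_exp_fps lam ((\<Sum>i=1..k. X i \<omega>) - real n * lam)
        = ?C * (\<Prod>i=1..k. deg_exp_fps lam (X i \<omega> - real (ls i) * lam))"
      by (simp only: deg_exp_fps_add[OF lam] deg_exp_fps_sum[OF lam finite_atLeastAtMost])
    moreover have "(\<Prod>i=1..k. F i (X i \<omega>))
        = fps_const (\<Prod>i=1..k. deg_ffact lam (X i \<omega>) (ls i))
          * (\<Prod>i=1..k. deg_exp_fps lam (X i \<omega> - real (ls i) * lam))"
      by (simp add: F_def higher_deriv_deg_exp_fps prod.distrib prod_fps_const)
    ultimately have "?C * (\<Prod>i=1..k. F i (X i \<omega>))
        = fps_const (\<Prod>i=1..k. deg_ffact lam (X i \<omega>) (ls i))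
          * deg_exp_fps lam ((\<Sum>i=1..k. X i \<omega>) - real n * lam)"
      by (simp only: mult_ac)
    then show ?thesis
      by (simp add: deg_exp_fps_def)
  qed
  have G: "Abs_fps (\<lambda>p. expectation (\<lambda>\<omega>. F i (X i \<omega>) $ p))
      = (fps_deriv ^^ ls i) (expect_deg_exp_fps N Y lam)" if "i \<ge> 1" for i
    by (rule fps_ext)
      (simp add: F_nth expM[OF that] fps_higher_deriv_nth expect_deg_exp_fps_def)
  have "?lhs = fact j * expectation (\<lambda>\<omega>. (?C * (\<Prod>i=1..k. F i (X i \<omega>))) $ j)"
    unfolding split by simp
  also have "expectation (\<lambda>\<omega>. (?C * (\<Prod>i=1..k. F i (X i \<omega>))) $ j)
      = (?C * (\<Prod>i=1..k. Abs_fps (\<lambda>p. expectation (\<lambda>\<omega>. F i (X i \<omega>) $ p)))) $ j"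
  proof (rule expectation_fps_prod_nth)
    show "indep_vars (\<lambda>_. borel) X {1..k}"
      by (rule indep_vars_subset[OF indep]) auto
  qed (auto simp: F_nth intM)
  also have "(\<Prod>i=1..k. Abs_fps (\<lambda>p. expectation (\<lambda>\<omega>. F i (X i \<omega>) $ p)))
      = (\<Prod>i=1..k. (fps_deriv ^^ ls i) (expect_deg_exp_fps N Y lam))"
    by (intro prod.cong refl G) simp
  finally show ?thesis .
qed

section \<open>Binomial convolution and assembly of the recurrence\<close>

lemma fact_mult_fps_mult_nth:
  "fact j * (f * g) $ j
    = (\<Sum>m=0..j. of_nat (j choose m) * (fact (j - m) * f $ (j - m)) * (fact m * g $ m :: 'a :: field_char_0))"
proof -
  have "fact j * (f * g) $ j = (\<Sum>m=0..j. fact j * (g $ m * f $ (j - m)))"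
    by (simp add: mult.commute[of f g] fps_mult_nth sum_distrib_left)
  also have "\<dots> = (\<Sum>m=0..j. of_nat (j choose m) * (fact (j - m) * f $ (j - m)) * (fact m * g $ m))"
  proof (rule sum.cong)
    fix m assume "m \<in> {0..j}"
    then have "(fact j :: 'a) = of_nat (j choose m) * fact (j - m) * fact m"
      by (simp add: binomial_fact)
    then show "fact j * (g $ m * f $ (j - m))
        = of_nat (j choose m) * (fact (j - m) * f $ (j - m)) * (fact m * g $ m)"
      by (simp only: mult_ac)
  qed simp
  finally show ?thesis .
qed

theorem theorem2p3:
  fixes lam y :: real and r n j :: nat
    and N :: "'b measure" and Y :: "'b \<Rightarrow> real"
    and M :: "'a measure" and Ys :: "nat \<Rightarrow> 'a \<Rightarrow> real"
  assumes "lam \<noteq> 0"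
    and "r > 0"
    and "prob_space N"
    and "Y \<in> borel_measurable N"
    and "mgf_exists_near_0 N Y"
    and "prob_space M"
    and "prob_space.indep_vars M (\<lambda>_. borel) Ys {1..}"
    and "\<And>i. i \<ge> 1 \<Longrightarrow> distr M borel (Ys i) = distr N borel Y"
  shows "prob_deg_r_bell N Y lam r (j + n) y =
    (\<Sum>l = 0..n. real (n choose l) * deg_ffact lam (real r) (n - l) *
      (\<Sum>k = 0..l. \<Sum>m = 0..j. y ^ k / fact k * real (j choose m) *
        (\<Sum>ls \<in> compositions l k. multinomial l k ls *
          (\<integral>\<omega>. deg_ffact lam ((\<Sum>i = 1..k. Ys i \<omega>) - real n * lam) (j - m) *
               (\<Prod>i = 1..k. deg_ffact lam (Ys i \<omega>) (ls i)) \<partial>M)) *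
        prob_deg_r_bell N Y lam r m y))"
proof -
  define G where "G = expect_deg_exp_fps N Y lam"
  define X where "X = fps_exp y oo (G - 1)"
  define R where "R = deg_exp_fps lam (real r)"
  define \<phi> where "\<phi> m = prob_deg_r_bell N Y lam r m y" for m
  have \<phi>: "\<phi> m = fact m * (R * X) $ m" for m
    by (simp add: \<phi>_def prob_deg_r_bell_def G_def X_def R_def mult.commute)
  define C where "C l = deg_exp_fps lam (- (real (n - l) * lam))" for l
  define D where "D k ls = (\<Prod>i=1..k. (fps_deriv ^^ ls i) G)" for k and ls :: "nat \<Rightarrow> nat"
  define E where "E k ls p = (\<integral>\<omega>. deg_ffact lam ((\<Sum>i=1..k. Ys i \<omega>) - real n * lam) p *
      (\<Prod>i=1..k. deg_ffact lam (Ys i \<omega>) (ls i)) \<partial>M)" for k ls p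
  have E: "E k ls p = fact p * (C l * D k ls) $ p" if "ls \<in> compositions l k" "l \<le> n" for l k ls p
    unfolding E_def C_def D_def G_def
    by (rule prob_space.expectation_deg_ffact_sum[OF assms(6,1,4,5,7,8) that])
  have G0: "G $ 0 = 1"
    using prob_space.prob_space[OF assms(3)]
    by (simp add: G_def expect_deg_exp_fps_def)
  have X_deriv: "(fps_deriv ^^ l) X = X * (\<Sum>k=0..l. fps_const (y ^ k / fact k) *
      (\<Sum>ls\<in>compositions l k. fps_const (multinomial l k ls) * D k ls))" for l
    unfolding X_def D_def
    by (simp only: higher_deriv_fps_exp_compose[OF G0] deriv_bell_eq_sum_compositions)
  \<comment> \<open>Splitting the exponent \<open>r - (n - l) * lam\<close> restores the full factor
    \<open>R\<close>. The remaining \<open>C l\<close> is exactly the shift that occurs in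
    \<open>E\<close>.\<close>
  have R_deriv: "(fps_deriv ^^ (n - l)) R = fps_const (deg_ffact lam (real r) (n - l)) * (C l * R)" for l
    using deg_exp_fps_add[OF assms(1), of "- (real (n - l) * lam)" "real r"]
    by (simp add: R_def C_def higher_deriv_deg_exp_fps)
  \<comment> \<open>Every term retains the undifferentiated \<open>R * X\<close>, whose coefficients
    will supply the \<open>\<phi> m\<close>.\<close>
  have "(fps_deriv ^^ n) (R * X)
      = (\<Sum>l=0..n. fps_const (real (n choose l) * deg_ffact lam (real r) (n - l)) *
          (\<Sum>k=0..l. fps_const (y ^ k / fact k) * (\<Sum>ls\<in>compositions l k.
            fps_const (multinomial l k ls) * ((C l * D k ls) * (R * X)))))"
    unfolding fps_higher_deriv_mult R_deriv X_deriv fps_const_mult[symmetric] fps_of_nat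
    by (simp only: sum_distrib_left mult_ac)
  then have "\<phi> (j + n) = fact j * \<dots> $ j"
    using fps_higher_deriv_nth[of n "R * X" j] by (simp add: \<phi>)
  also have "\<dots> = (\<Sum>l=0..n. real (n choose l) * deg_ffact lam (real r) (n - l) *
      (\<Sum>k=0..l. y ^ k / fact k * (\<Sum>ls\<in>compositions l k.
        multinomial l k ls * (fact j * ((C l * D k ls) * (R * X)) $ j))))"
    unfolding fps_sum_nth fps_mult_left_const_nth sum_distrib_left
    by (simp only: mult_ac)
  \<comment> \<open>Binomial convolution separates \<open>C l * D k ls\<close> from
    \<open>R * X\<close>; the first factor becomes the expectation at index \<open>j - m\<close>,
    the second \<open>\<phi> m\<close>.\<close>
  also have "\<dots> = (\<Sum>l=0..n. real (n choose l) * deg_ffact lam (real r) (n - l) *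
      (\<Sum>k=0..l. y ^ k / fact k * (\<Sum>ls\<in>compositions l k.
        multinomial l k ls * (\<Sum>m=0..j. real (j choose m) * E k ls (j - m) * \<phi> m))))"
    unfolding \<phi> fact_mult_fps_mult_nth[of _ "C _ * D _ _"] by (simp add: E)
  also have "\<dots> = (\<Sum>l=0..n. real (n choose l) * deg_ffact lam (real r) (n - l) *
      (\<Sum>k=0..l. \<Sum>m=0..j. y ^ k / fact k * real (j choose m) *
        (\<Sum>ls\<in>compositions l k. multinomial l k ls * E k ls (j - m)) * \<phi> m))"
  proof (intro sum.cong refl arg_cong2[of _ _ _ _ "(*)"])
    fix l k
    show "y ^ k / fact k * (\<Sum>ls\<in>compositions l k.
          multinomial l k ls * (\<Sum>m=0..j. real (j choose m) * E k ls (j - m) * \<phi> m))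
        = (\<Sum>m=0..j. y ^ k / fact k * real (j choose m) *
            (\<Sum>ls\<in>compositions l k. multinomial l k ls * E k ls (j - m)) * \<phi> m)"
      unfolding sum_distrib_left sum_distrib_right
      by (subst sum.swap) (simp only: mult_ac)
  qed
  finally show ?thesis
    unfolding \<phi>_def E_def .
qed

end
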